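(* Let $k\ge 1$ and let $1\le n_1\le n_2\le\cdots\le n_k$ be integers. Then $$n_k\ \le\ \operatorname{tdepth}\llbracket n_1,n_2,\dots,n_k\rrbracket\ \le\ \max\{n_k,\ n_1+n_2+\cdots+n_{k-1}\},$$ and $$\operatorname{tdepth}\llbracket n_1,n_2,\dots,n_k\rrbracket\ \le\ \left\lfloor\frac1k\sum_{i=1}^k i\,n_i\right\rfloor.$$
   Context: For positive integers $n_1,\dots,n_k$, let $\llbracket n_1,\dots,n_k\rrbracket$ denote the poset of nonempty submultisets of the multiset $\{1^{n_1},\dots,k^{n_k}\}$ ordered by inclusion; equivalently, the set of nonzero tuples $(a_1,\dots,a_k)$ of integers with $0\le a_j\le n_j$ for all $j$, ordered componentwise. An interval in a finite poset $P$ is a set $[X,Y]=\{Z\in P: X\le Z\le Y\}$ with $X\le Y$ in $P$; $Y$ is its top element. An interval partition of $P$ is a partition of $P$ into nonempty pairwise disjoint intervals. The height of $Z\in P$ is the maximal size $n$ of a chain $Z=Z_1>Z_2>\cdots>Z_n$ in $P$ (in $\llbracket n_1,\dots,n_k\rrbracket$ the height of $(z_1,\dots,z_k)$ is $z_1+\cdots+z_k$). The total depth of an interval partition $\pi$ is $\operatorname{tdepth}\pi=\min_{[X,Y]\in\pi}\operatorname{height}Y$, and the total depth of $P$ is $\operatorname{tdepth}P=\max_\pi\operatorname{tdepth}\pi$ over all interval partitions $\pi$ of $P$. *)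

theory Defs
  imports Complex_Main "HOL-Library.Multiset" "HOL-Library.Disjoint_Sets"
begin

text \<open>
  A finite poset is given by its carrier \<open>P\<close> together with its order relation \<open>le\<close>.  The relation
  is a parameter because submultiset inclusion \<open>(\<subseteq>#)\<close> is not an instance of the
  type class \<^class>\<open>order\<close>.
\<close>

definition interval :: "('a \<Rightarrow> 'a \<Rightarrow> bool) \<Rightarrow> 'a set \<Rightarrow> 'a \<Rightarrow> 'a \<Rightarrow> 'a set" where
  "interval le P X Y = {Z \<in> P. le X Z \<and> le Z Y}"

definition interval_partition :: "('a \<Rightarrow> 'a \<Rightarrow> bool) \<Rightarrow> 'a set \<Rightarrow> 'a set set \<Rightarrow> bool" where
  "interval_partition le P \<pi> \<longleftrightarrow>
     partition_on P \<pi> \<and>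
     (\<forall>I\<in>\<pi>. \<exists>X\<in>P. \<exists>Y\<in>P. le X Y \<and> I = interval le P X Y)"

text \<open>A chain \<open>Z = Z\<^sub>1 > \<dots> > Z\<^sub>n\<close> in \<open>P\<close> is a strictly decreasing list with head \<open>Z\<close>.\<close>

definition height :: "('a \<Rightarrow> 'a \<Rightarrow> bool) \<Rightarrow> 'a set \<Rightarrow> 'a \<Rightarrow> nat" where
  "height le P Z =
     Max {length zs | zs. zs \<noteq> [] \<and> hd zs = Z \<and> set zs \<subseteq> P \<and>
                          sorted_wrt (\<lambda>x y. le y x \<and> y \<noteq> x) zs}"

text \<open>
  The endpoints \<open>X \<le> Y\<close> of a nonempty interval are determined by the interval, so the minimum below
  has exactly one entry for each member of \<open>\<pi>\<close>.
\<close>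

definition partition_tdepth :: "('a \<Rightarrow> 'a \<Rightarrow> bool) \<Rightarrow> 'a set \<Rightarrow> 'a set set \<Rightarrow> nat" where
  "partition_tdepth le P \<pi> =
     Min {height le P Y | X Y. X \<in> P \<and> Y \<in> P \<and> le X Y \<and> interval le P X Y \<in> \<pi>}"

definition tdepth :: "('a \<Rightarrow> 'a \<Rightarrow> bool) \<Rightarrow> 'a set \<Rightarrow> nat" where
  "tdepth le P = Max {partition_tdepth le P \<pi> | \<pi>. interval_partition le P \<pi>}"

text \<open>The nonempty submultisets of \<open>{1^n\<^sub>1, \<dots>, k^n\<^sub>k}\<close>; only the values \<open>n 1, \<dots>, n k\<close> matter.\<close>

definition nonempty_submultisets :: "nat \<Rightarrow> (nat \<Rightarrow> nat) \<Rightarrow> nat multiset set" where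
  "nonempty_submultisets k n =
     {X. X \<noteq> {#} \<and> X \<subseteq># (\<Sum>j=1..k. replicate_mset (n j) j)}"

definition tdepth_mset :: "nat \<Rightarrow> (nat \<Rightarrow> nat) \<Rightarrow> nat" where
  "tdepth_mset k n = tdepth (\<subseteq>#) (nonempty_submultisets k n)"

end

theory Submission
  imports Defs
begin

text \<open>
  The height of a nonempty submultiset is its size, so the theorem compares the sizes of the top
  elements of blocks.

  For the lower bound, fix all multiplicities except the one of the most frequent element.  The
  submultisets that agree with such a choice form a chain, which is an interval whose top contains
  all \<open>n k\<close> copies of that element.  These chains partition the poset
  (\<open>interval_partition_remove_element\<close>).

  For the upper bounds, look only at the \<open>k\<close> blocks that contain the singletons.  A
  singleton \<open>{#i#}\<close> is minimal, so it is the bottom of its block \<open>[{#i#}, Y i]\<close>.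
  If \<open>i \<noteq> j\<close>, then \<open>j \<in># Y i\<close> and \<open>i \<in># Y j\<close> cannot both hold, since otherwise
  \<open>{#i, j#}\<close> would lie in two blocks (\<open>singleton_block_tops\<close>).  Two countings follow.  Every pair
  \<open>i < j\<close> contributes to only one of \<open>Y i\<close> and \<open>Y j\<close>, hence at most
  \<open>n j\<close> to the total size, and \<open>i\<close> contributes at most \<open>n i\<close> to \<open>Y i\<close>; so the total size is
  at most \<open>\<Sum>j. j * n j\<close> and some top has at most the average size.  And either some
  \<open>Y i\<close> with \<open>i < k\<close> avoids \<open>k\<close>, which leaves room for at most \<open>n 1 + \<dots> + n (k - 1)\<close>
  elements, or all of them contain \<open>k\<close>, so that \<open>Y k\<close> avoids every \<open>i < k\<close> and consists of copies of \<open>k\<close> only.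
\<close>

abbreviation nonempty_submsets :: "'a multiset \<Rightarrow> 'a multiset set" where
  "nonempty_submsets M \<equiv> {X. X \<noteq> {#} \<and> X \<subseteq># M}"

lemma finite_submsets: "finite {X. X \<subseteq># M}"
proof (induction M)
  case empty
  then show ?case by simp
next
  case (add x M)
  have "{X. X \<subseteq># add_mset x M} \<subseteq> {X. X \<subseteq># M} \<union> add_mset x ` {X. X \<subseteq># M}"
  proof
    fix X assume X: "X \<in> {X. X \<subseteq># add_mset x M}"
    show "X \<in> {X. X \<subseteq># M} \<union> add_mset x ` {X. X \<subseteq># M}"
    proof (cases "x \<in># X")
      case True
      then obtain Z where "X = add_mset x Z" by (metis insert_DiffM)
      then show ?thesis using X by auto
    next
      case False
      then show ?thesis using X
        by (metis (no_types, lifting) UnI1 diff_single_trivial mem_Collect_eq subset_eq_diff_conv add_mset_add_single)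
    qed
  qed
  then show ?case using add by (meson finite_UnI finite_imageI finite_subset)
qed

lemma finite_nonempty_submsets: "finite (nonempty_submsets M)"
  by (rule finite_subset[OF _ finite_submsets[of M]]) auto

section \<open>Heights of submultisets\<close>

text \<open>Sizes drop by at least one along a chain and end at one or more.\<close>

lemma length_chain_le_size:
  assumes "zs \<noteq> []" "{#} \<notin> set zs" "sorted_wrt (\<lambda>x y. y \<subseteq># x \<and> y \<noteq> x) zs"
  shows "length zs \<le> size (hd zs)"
  using assms
proof (induction zs)
  case Nil
  then show ?case by simp
next
  case (Cons z zs)
  show ?case
  proof (cases "zs = []")
    case True
    then show ?thesis using Cons.prems by (simp add: Suc_le_eq nonempty_has_size[symmetric])
  next
    case False
    then have "hd zs \<subset># z" using Cons.prems by (simp add: subset_mset.less_le)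
    then have "size (hd zs) < size z" by (rule mset_subset_size)
    then show ?thesis using Cons False by fastforce
  qed
qed

text \<open>Removing the elements one at a time gives a chain of the maximal length.\<close>

lemma ex_chain_length_size:
  assumes "Z \<noteq> {#}"
  shows "\<exists>zs. zs \<noteq> [] \<and> hd zs = Z \<and> (\<forall>X\<in>set zs. X \<noteq> {#} \<and> X \<subseteq># Z) \<and>
    sorted_wrt (\<lambda>x y. y \<subseteq># x \<and> y \<noteq> x) zs \<and> length zs = size Z"
  using assms
proof (induction Z)
  case empty
  then show ?case by simp
next
  case (add x Z)
  show ?case
  proof (cases "Z = {#}")
    case True
    then show ?thesis by (intro exI[of _ "[{#x#}]"]) simp
  next
    case False
    then obtain zs where zs: "zs \<noteq> []" "\<forall>X\<in>set zs. X \<noteq> {#} \<and> X \<subseteq># Z"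
      "sorted_wrt (\<lambda>x y. y \<subseteq># x \<and> y \<noteq> x) zs" "length zs = size Z"
      using add by blast
    have "X \<subseteq># add_mset x Z \<and> X \<noteq> add_mset x Z" if "X \<subseteq># Z" for X
      using that by (metis add_mset_add_single mset_subset_eq_add_left multi_self_add_other_not_self
          subset_mset.antisym subset_mset.order_trans)
    then show ?thesis using zs by (intro exI[of _ "add_mset x Z # zs"]) auto
  qed
qed

lemma height_nonempty_submsets:
  assumes "Z \<in> nonempty_submsets M"
  shows "height (\<subseteq>#) (nonempty_submsets M) Z = size Z"
proof -
  let ?L = "{length zs | zs. zs \<noteq> [] \<and> hd zs = Z \<and> set zs \<subseteq> nonempty_submsets M \<and>
              sorted_wrt (\<lambda>x y. y \<subseteq># x \<and> y \<noteq> x) zs}"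
  have le: "l \<le> size Z" if "l \<in> ?L" for l
    using that length_chain_le_size by fastforce
  then have "finite ?L" by (meson finite_nat_set_iff_bounded_le)
  moreover have "size Z \<in> ?L"
  proof -
    obtain zs where zs: "zs \<noteq> []" "hd zs = Z" "\<forall>X\<in>set zs. X \<noteq> {#} \<and> X \<subseteq># Z"
      "sorted_wrt (\<lambda>x y. y \<subseteq># x \<and> y \<noteq> x) zs" "length zs = size Z"
      using ex_chain_length_size assms by blast
    then have "set zs \<subseteq> nonempty_submsets M"
      using assms subset_mset.order_trans by blast
    with zs show ?thesis by (intro CollectI exI[of _ zs]) simp
  qed
  ultimately show ?thesis unfolding height_def using le by (intro Max_eqI) auto
qed

section \<open>Total depth in a finite poset\<close>

lemma finite_block_heights:
  assumes "finite P"
  shows "finite {height le P Y | X Y. X \<in> P \<and> Y \<in> P \<and> le X Y \<and> interval le P X Y \<in> \<pi>}"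
  by (rule finite_subset[of _ "height le P ` P"]) (use assms in auto)

lemma partition_tdepth_le_height:
  assumes "finite P" "X \<in> P" "Y \<in> P" "le X Y" "interval le P X Y \<in> \<pi>"
  shows "partition_tdepth le P \<pi> \<le> height le P Y"
  unfolding partition_tdepth_def
  by (rule Min_le[OF finite_block_heights]) (use assms in auto)

lemma finite_partition_tdepths:
  assumes "finite P"
  shows "finite {partition_tdepth le P \<pi> | \<pi>. interval_partition le P \<pi>}"
proof (rule finite_subset)
  show "{partition_tdepth le P \<pi> | \<pi>. interval_partition le P \<pi>} \<subseteq>
      partition_tdepth le P ` {\<pi>. partition_on P \<pi>}"
    by (auto simp: interval_partition_def)
qed (use finitely_many_partition_on[OF assms] in simp)

lemma tdepth_ge:
  assumes "finite P" "P \<noteq> {}" "interval_partition le P \<pi>"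
    and tops: "\<And>X Y. X \<in> P \<Longrightarrow> Y \<in> P \<Longrightarrow> le X Y \<Longrightarrow> interval le P X Y \<in> \<pi> \<Longrightarrow> d \<le> height le P Y"
  shows "d \<le> tdepth le P"
proof -
  let ?H = "{height le P Y | X Y. X \<in> P \<and> Y \<in> P \<and> le X Y \<and> interval le P X Y \<in> \<pi>}"
  obtain I where "I \<in> \<pi>"
    using assms(2,3) by (auto simp: interval_partition_def partition_on_def)
  have "\<forall>I\<in>\<pi>. \<exists>X\<in>P. \<exists>Y\<in>P. le X Y \<and> I = interval le P X Y"
    using assms(3) by (simp add: interval_partition_def)
  from bspec[OF this \<open>I \<in> \<pi>\<close>]
  obtain X Y where "X \<in> P" "Y \<in> P" "le X Y" "I = interval le P X Y"
    by (elim bexE conjE)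
  then have "height le P Y \<in> ?H" using \<open>I \<in> \<pi>\<close> by (intro CollectI exI conjI) simp_all
  then have "?H \<noteq> {}" by (metis empty_iff)
  then have "d \<le> partition_tdepth le P \<pi>"
    unfolding partition_tdepth_def using finite_block_heights[OF assms(1)] tops
    by (subst Min_ge_iff) auto
  also have "\<dots> \<le> tdepth le P"
    unfolding tdepth_def by (rule Max_ge[OF finite_partition_tdepths]) (use assms in auto)
  finally show ?thesis .
qed

lemma tdepth_attained:
  assumes "finite P" "\<exists>\<pi>. interval_partition le P \<pi>"
  obtains \<pi> where "interval_partition le P \<pi>" "tdepth le P = partition_tdepth le P \<pi>"
proof -
  have "tdepth le P \<in> {partition_tdepth le P \<pi> | \<pi>. interval_partition le P \<pi>}"
    unfolding tdepth_def by (rule Max_in[OF finite_partition_tdepths]) (use assms in auto)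
  then show ?thesis using that by auto
qed

section \<open>A partition into chains\<close>

text \<open>
  The block of \<open>Z\<close> consists of the nonempty submultisets that differ from \<open>Z\<close> only in the
  multiplicity of \<open>a\<close>.  If \<open>Z\<close> has no element other than \<open>a\<close>, the chain must start at \<open>{#a#}\<close>
  because the empty multiset is not in the poset.
\<close>

lemma interval_remove_element:
  assumes "a \<in># M" "Z \<in> nonempty_submsets M"
  defines "R \<equiv> filter_mset (\<lambda>x. x \<noteq> a) Z"
  defines "B \<equiv> if R = {#} then {#a#} else R"
  defines "T \<equiv> R + replicate_mset (count M a) a"
  shows "B \<in> nonempty_submsets M" "T \<in> nonempty_submsets M" "B \<subseteq># T"
    and "interval (\<subseteq>#) (nonempty_submsets M) B T =
      {W \<in> nonempty_submsets M. filter_mset (\<lambda>x. x \<noteq> a) W = R}"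
proof -
  have cM: "count M a \<ge> 1" using assms(1) by simp
  have cR: "count R x = (if x = a then 0 else count Z x)" for x
    unfolding R_def by simp
  have ZM: "count Z x \<le> count M x" for x
    using assms(2) by (simp add: mset_subset_eq_count)
  have "T \<subseteq># M" unfolding T_def subseteq_mset_def using cR ZM by simp
  moreover have "T \<noteq> {#}" using cM unfolding T_def by auto
  ultimately show T: "T \<in> nonempty_submsets M" by simp
  show BT: "B \<subseteq># T" unfolding B_def T_def subseteq_mset_def using cM by simp
  have "B \<noteq> {#}" unfolding B_def by simp
  then show B: "B \<in> nonempty_submsets M" using BT \<open>T \<subseteq># M\<close> by auto
  show "interval (\<subseteq>#) (nonempty_submsets M) B T =
      {W \<in> nonempty_submsets M. filter_mset (\<lambda>x. x \<noteq> a) W = R}"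
  proof (intro equalityI subsetI)
    fix W assume "W \<in> interval (\<subseteq>#) (nonempty_submsets M) B T"
    then have W: "W \<in> nonempty_submsets M" and c: "count B x \<le> count W x" "count W x \<le> count T x" for x
      by (auto simp: interval_def subseteq_mset_def)
    have "count W x = count R x" if "x \<noteq> a" for x
    proof (rule antisym)
      show "count W x \<le> count R x" using c(2)[of x] that unfolding T_def by simp
      show "count R x \<le> count W x" using c(1)[of x] unfolding B_def by (cases "R = {#}") auto
    qed
    then have "filter_mset (\<lambda>x. x \<noteq> a) W = R" by (intro multiset_eqI) (simp add: cR)
    then show "W \<in> {W \<in> nonempty_submsets M. filter_mset (\<lambda>x. x \<noteq> a) W = R}" using W by simp
  next
    fix W assume "W \<in> {W \<in> nonempty_submsets M. filter_mset (\<lambda>x. x \<noteq> a) W = R}"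
    then have W: "W \<noteq> {#}" "W \<subseteq># M" and f: "filter_mset (\<lambda>x. x \<noteq> a) W = R" by auto
    have cW: "count W x = count R x" if "x \<noteq> a" for x using f that by auto
    have "W \<subseteq># T" unfolding T_def subseteq_mset_def
      using cW W(2) cR by (auto simp: mset_subset_eq_count)
    moreover have "B \<subseteq># W"
    proof (cases "R = {#}")
      case True
      then have "\<forall>x\<in>#W. x = a" using f
        by (metis (mono_tags, lifting) empty_iff filter_mset_eq_conv mem_Collect_eq set_mset_empty
            set_mset_filter)
      then have "a \<in># W" using W(1) by (metis multiset_nonemptyE)
      then show ?thesis using True unfolding B_def by simp
    next
      case False
      then show ?thesis using f unfolding B_def by (metis multiset_filter_subset)
    qed
    ultimately show "W \<in> interval (\<subseteq>#) (nonempty_submsets M) B T"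
      using W by (simp add: interval_def)
  qed
qed

lemma interval_partition_remove_element:
  assumes "a \<in># M"
  defines "P \<equiv> nonempty_submsets M"
  defines "\<pi> \<equiv> (\<lambda>Z. {W \<in> P. filter_mset (\<lambda>x. x \<noteq> a) W = filter_mset (\<lambda>x. x \<noteq> a) Z}) ` P"
  shows "interval_partition (\<subseteq>#) P \<pi>"
  unfolding interval_partition_def
proof
  show "partition_on P \<pi>"
    unfolding \<pi>_def by (rule partition_onI) (auto simp: disjnt_def)
  show "\<forall>I\<in>\<pi>. \<exists>X\<in>P. \<exists>Y\<in>P. X \<subseteq># Y \<and> I = interval (\<subseteq>#) P X Y"
  proof
    fix I assume "I \<in> \<pi>"
    then obtain Z where "Z \<in> P" and I_eq: "I = {W \<in> P. filter_mset (\<lambda>x. x \<noteq> a) W = filter_mset (\<lambda>x. x \<noteq> a) Z}"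
      unfolding \<pi>_def by (rule imageE) simp
    note block = interval_remove_element[OF assms(1) \<open>Z \<in> P\<close>[unfolded P_def], folded P_def]
    show "\<exists>X\<in>P. \<exists>Y\<in>P. X \<subseteq># Y \<and> I = interval (\<subseteq>#) P X Y"
      unfolding I_eq
      by (intro bexI conjI, rule block(3), rule block(4)[symmetric], rule block(2), rule block(1))
  qed
qed

lemma count_le_tdepth:
  assumes "a \<in># M"
  shows "count M a \<le> tdepth (\<subseteq>#) (nonempty_submsets M)"
proof (rule tdepth_ge[OF finite_nonempty_submsets _ interval_partition_remove_element[OF assms]])
  show "nonempty_submsets M \<noteq> {}" using assms by (auto intro!: exI[of _ "{#a#}"])
next
  let ?P = "nonempty_submsets M"
  let ?f = "filter_mset (\<lambda>x. x \<noteq> a)"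
  fix X Y assume X: "X \<in> ?P" and Y: "Y \<in> ?P" and XY: "X \<subseteq># Y"
    and "interval (\<subseteq>#) ?P X Y \<in> (\<lambda>Z. {W \<in> ?P. ?f W = ?f Z}) ` ?P"
  then obtain Z where Z: "interval (\<subseteq>#) ?P X Y = {W \<in> ?P. ?f W = ?f Z}" by blast
  have Yin: "Y \<in> interval (\<subseteq>#) ?P X Y" using Y XY by (simp add: interval_def)
  then have fY: "?f Y = ?f Z" using Z by blast
  \<comment> \<open>The block is closed under raising the multiplicity of \<open>a\<close>, so its top has all copies of \<open>a\<close>.\<close>
  let ?T = "?f Y + replicate_mset (count M a) a"
  have "?T \<in> ?P" using interval_remove_element(2)[OF assms Y] .
  moreover have "?f ?T = ?f Z" using fY by (auto intro!: multiset_eqI)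
  ultimately have "?T \<in> interval (\<subseteq>#) ?P X Y" using Z by blast
  then have "?T \<subseteq># Y" by (simp add: interval_def)
  then have "size ?T \<le> size Y" by (rule size_mset_mono)
  then show "count M a \<le> height (\<subseteq>#) ?P Y"
    using height_nonempty_submsets[OF Y] by simp
qed

section \<open>The blocks of the singletons\<close>

text \<open>
  A singleton is minimal, hence the bottom of its block; and \<open>{#x, y#}\<close> lies in at most one of the
  blocks of \<open>{#x#}\<close> and \<open>{#y#}\<close>, which are different.
\<close>

lemma singleton_block_tops:
  assumes \<pi>: "interval_partition (\<subseteq>#) (nonempty_submsets M) \<pi>"
  obtains Y where
    "\<And>x. x \<in># M \<Longrightarrow> Y x \<subseteq># M"
    "\<And>x. x \<in># M \<Longrightarrow> partition_tdepth (\<subseteq>#) (nonempty_submsets M) \<pi> \<le> size (Y x)"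
    "\<And>x y. x \<in># M \<Longrightarrow> y \<in># M \<Longrightarrow> x \<noteq> y \<Longrightarrow> y \<notin># Y x \<or> x \<notin># Y y"
proof -
  let ?P = "nonempty_submsets M"
  have part: "partition_on ?P \<pi>" using \<pi> by (simp add: interval_partition_def)
  have "\<forall>x\<in>#M. \<exists>Y. Y \<in> ?P \<and> {#x#} \<subseteq># Y \<and> interval (\<subseteq>#) ?P {#x#} Y \<in> \<pi>"
  proof
    fix x assume x: "x \<in># M"
    have xP: "{#x#} \<in> ?P" using x by simp
    then obtain I where I: "I \<in> \<pi>" "{#x#} \<in> I"
      using part by (metis UnionE partition_onD1)
    then obtain X Y where XY: "X \<in> ?P" "Y \<in> ?P" "I = interval (\<subseteq>#) ?P X Y"
      using \<pi> unfolding interval_partition_def by blast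
    then have "X \<subseteq># {#x#}" "{#x#} \<subseteq># Y" using I(2) by (auto simp: interval_def)
    moreover have "X = {#x#}" using \<open>X \<subseteq># {#x#}\<close> XY(1)
      by (metis (mono_tags, lifting) mem_Collect_eq subset_mset.le_less subset_mset.less_le
          mset_subset_size size_single less_one size_eq_0_iff_empty)
    ultimately show "\<exists>Y. Y \<in> ?P \<and> {#x#} \<subseteq># Y \<and> interval (\<subseteq>#) ?P {#x#} Y \<in> \<pi>"
      using XY I by blast
  qed
  from bchoice[OF this] obtain Y where Y: "\<And>x. x \<in># M \<Longrightarrow> Y x \<in> ?P" "\<And>x. x \<in># M \<Longrightarrow> {#x#} \<subseteq># Y x"
    "\<And>x. x \<in># M \<Longrightarrow> interval (\<subseteq>#) ?P {#x#} (Y x) \<in> \<pi>"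
    by blast
  show ?thesis
  proof (rule that[of Y])
    show "Y x \<subseteq># M" if "x \<in># M" for x using Y(1)[OF that] by simp
    show "partition_tdepth (\<subseteq>#) ?P \<pi> \<le> size (Y x)" if x: "x \<in># M" for x
      using partition_tdepth_le_height[OF finite_nonempty_submsets _ Y(1)[OF x] Y(2)[OF x] Y(3)[OF x]]
        height_nonempty_submsets[OF Y(1)[OF x]] x by simp
    show "y \<notin># Y x \<or> x \<notin># Y y" if x: "x \<in># M" and y: "y \<in># M" and ne: "x \<noteq> y" for x y
    proof (rule ccontr)
      assume "\<not> (y \<notin># Y x \<or> x \<notin># Y y)"
      moreover have "x \<in># Y x" "y \<in># Y y" using Y(2) x y by auto
      ultimately have sub: "{#x, y#} \<subseteq># Y x" "{#x, y#} \<subseteq># Y y" "{#x, y#} \<subseteq># M"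
        using ne x y by (auto simp: insert_subset_eq_iff in_diff_count)
      then have "{#x, y#} \<in> interval (\<subseteq>#) ?P {#x#} (Y x)"
        and "{#x, y#} \<in> interval (\<subseteq>#) ?P {#y#} (Y y)"
        by (auto simp: interval_def)
      then have eq: "interval (\<subseteq>#) ?P {#x#} (Y x) = interval (\<subseteq>#) ?P {#y#} (Y y)"
        using Y(3)[OF x] Y(3)[OF y] partition_onD2[OF part] by (meson disjointD disjoint_iff)
      have "{#x#} \<in> interval (\<subseteq>#) ?P {#x#} (Y x)"
        using Y(2)[OF x] x by (simp add: interval_def)
      then have "{#x#} \<in> interval (\<subseteq>#) ?P {#y#} (Y y)" unfolding eq .
      then have "{#y#} \<subseteq># {#x#}" by (simp add: interval_def)
      then show False using ne by simp
    qed
  qed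
qed

section \<open>Counting the sizes of the tops\<close>

text \<open>
  Group the entries of the square by the larger index: the index \<open>j\<close> owns \<open>j - 1\<close> symmetric pairs
  and one diagonal entry, each of them at most \<open>n j\<close>.
\<close>

lemma sum_square_le_weighted_sum:
  fixes c :: "nat \<Rightarrow> nat \<Rightarrow> nat"
  assumes "\<And>i. 1 \<le> i \<Longrightarrow> i \<le> k \<Longrightarrow> c i i \<le> n i"
    and "\<And>i j. 1 \<le> i \<Longrightarrow> i < j \<Longrightarrow> j \<le> k \<Longrightarrow> c i j + c j i \<le> n j"
  shows "(\<Sum>i=1..k. \<Sum>j=1..k. c i j) \<le> (\<Sum>i=1..k. i * n i)"
  using assms
proof (induction k)
  case 0
  then show ?case by simp
next
  case (Suc k)
  have "(\<Sum>i=1..Suc k. \<Sum>j=1..Suc k. c i j) =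
      (\<Sum>i=1..k. \<Sum>j=1..k. c i j) + (\<Sum>i=1..k. c i (Suc k) + c (Suc k) i) + c (Suc k) (Suc k)"
    by (simp add: sum.distrib)
  also have "\<dots> \<le> (\<Sum>i=1..k. i * n i) + (\<Sum>i=1..k. n (Suc k)) + n (Suc k)"
  proof (rule add_mono[OF add_mono])
    show "(\<Sum>i=1..k. \<Sum>j=1..k. c i j) \<le> (\<Sum>i=1..k. i * n i)"
      using Suc by simp
    show "(\<Sum>i=1..k. c i (Suc k) + c (Suc k) i) \<le> (\<Sum>i=1..k. n (Suc k))"
      using Suc.prems(2) by (intro sum_mono) simp
  qed (use Suc.prems(1) in simp)
  also have "\<dots> = (\<Sum>i=1..Suc k. i * n i)" by simp
  finally show ?case .
qed

lemma count_sum_replicate_mset: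
  fixes k :: nat
  shows "count (\<Sum>j=1..k. replicate_mset (n j) j) x = (if x \<in> {1..k} then n x else 0)"
  by (simp add: count_sum)

theorem theorem6p1:
  fixes k :: nat and n :: "nat \<Rightarrow> nat"
  assumes "k \<ge> 1"
    and "1 \<le> n 1"
    and "\<And>i j. 1 \<le> i \<Longrightarrow> i \<le> j \<Longrightarrow> j \<le> k \<Longrightarrow> n i \<le> n j"
  shows "n k \<le> tdepth_mset k n
       \<and> tdepth_mset k n \<le> max (n k) (\<Sum>i=1..<k. n i)
       \<and> int (tdepth_mset k n) \<le> \<lfloor>(1 / real k) * (\<Sum>i=1..k. real i * real (n i))\<rfloor>"
proof -
  define M where "M = (\<Sum>j=1..k. replicate_mset (n j) j)"
  have cM: "count M x = (if x \<in> {1..k} then n x else 0)" for x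
    unfolding M_def by (rule count_sum_replicate_mset)
  have inM: "x \<in># M" if "1 \<le> x" "x \<le> k" for x
    using that assms(2) assms(3)[of 1 x] cM[of x] by (simp add: count_inI)
  let ?d = "tdepth_mset k n"
  have d: "?d = tdepth (\<subseteq>#) (nonempty_submsets M)"
    unfolding tdepth_mset_def nonempty_submultisets_def M_def ..

  have lower: "n k \<le> ?d"
    using count_le_tdepth[OF inM[of k]] assms(1) cM[of k] d by simp

  have "k \<in># M" using inM assms(1) by simp
  from interval_partition_remove_element[OF this]
  have "\<exists>\<pi>. interval_partition (\<subseteq>#) (nonempty_submsets M) \<pi>" by (rule exI)
  from tdepth_attained[OF finite_nonempty_submsets this, folded d] obtain \<pi> where \<pi>: "interval_partition (\<subseteq>#) (nonempty_submsets M) \<pi>"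
    and d_\<pi>: "?d = partition_tdepth (\<subseteq>#) (nonempty_submsets M) \<pi>"
    by blast
  obtain Y where YM: "\<And>x. x \<in># M \<Longrightarrow> Y x \<subseteq># M"
    and dY: "\<And>x. x \<in># M \<Longrightarrow> ?d \<le> size (Y x)"
    and Y_disj: "\<And>x y. x \<in># M \<Longrightarrow> y \<in># M \<Longrightarrow> x \<noteq> y \<Longrightarrow> y \<notin># Y x \<or> x \<notin># Y y"
    using singleton_block_tops[OF \<pi>, folded d_\<pi>] by blast
  have cY: "count (Y i) j \<le> n j" if "1 \<le> i" "i \<le> k" for i j
    using mset_subset_eq_count[OF YM[OF inM[OF that]], of j] cM[of j] by (simp split: if_splits)
  have sizeY: "size (Y i) = (\<Sum>j=1..k. count (Y i) j)" if "1 \<le> i" "i \<le> k" for i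
  proof -
    have "set_mset (Y i) \<subseteq> {1..k}"
      using set_mset_mono[OF YM[OF inM[OF that]]] cM by (metis (full_types) not_in_iff subsetI subsetD)
    then show ?thesis unfolding size_multiset_overloaded_eq
      by (intro sum.mono_neutral_left) (auto simp: not_in_iff)
  qed

  have split_k: "(\<Sum>j=1..k. f j) = (\<Sum>j=1..<k. f j) + f k" for f :: "nat \<Rightarrow> nat"
    using assms(1) by (simp add: sum.last_plus add.commute)
  have upper1: "?d \<le> max (n k) (\<Sum>i=1..<k. n i)"
  proof (cases "\<exists>i. 1 \<le> i \<and> i < k \<and> k \<notin># Y i")
    case True
    then obtain i where i: "1 \<le> i" "i < k" "k \<notin># Y i" by blast
    have "?d \<le> size (Y i)" using dY inM i by simp
    also have "\<dots> = (\<Sum>j=1..<k. count (Y i) j)"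
      using sizeY[of i] split_k i by (simp add: not_in_iff)
    also have "\<dots> \<le> (\<Sum>j=1..<k. n j)" using cY i by (intro sum_mono) simp
    finally show ?thesis by simp
  next
    case False
    have "count (Y k) j = 0" if "j \<in> {1..<k}" for j
      using that False Y_disj[of j k] inM by (auto simp: not_in_iff)
    then have "size (Y k) = count (Y k) k" using sizeY[of k] split_k assms(1) by simp
    then have "?d \<le> n k" using dY[OF inM[of k]] cY[of k k] assms(1) by simp
    then show ?thesis by simp
  qed

  have "k * ?d = (\<Sum>i=1..k. ?d)" by simp
  also have "\<dots> \<le> (\<Sum>i=1..k. size (Y i))" using dY inM by (intro sum_mono) simp
  also have "\<dots> = (\<Sum>i=1..k. \<Sum>j=1..k. count (Y i) j)" using sizeY by simp
  also have "\<dots> \<le> (\<Sum>i=1..k. i * n i)"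
  proof (rule sum_square_le_weighted_sum)
    fix i j assume ij: "1 \<le> i" "i < j" "j \<le> k"
    have "count (Y i) j = 0 \<or> count (Y j) i = 0"
      using Y_disj[of i j] inM ij by (simp add: not_in_iff)
    moreover have "count (Y i) j \<le> n j" "count (Y j) i \<le> n i" "n i \<le> n j"
      using cY assms(3) ij by auto
    ultimately show "count (Y i) j + count (Y j) i \<le> n j" by linarith
  qed (use cY in simp)
  finally have "real (k * ?d) \<le> real (\<Sum>i=1..k. i * n i)" by (rule of_nat_mono)
  then have "real ?d \<le> (1 / real k) * (\<Sum>i=1..k. real i * real (n i))"
    using assms(1) by (simp add: field_simps)
  then have upper2: "int ?d \<le> \<lfloor>(1 / real k) * (\<Sum>i=1..k. real i * real (n i))\<rfloor>"
    by (simp add: le_floor_iff)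
  show ?thesis using lower upper1 upper2 by blast
qed

end
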